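(* Let $u^\dagger$ be an $\Omega$-minimizing solution which satisfies a variational inequality with exponent $\kappa$, where $0<\kappa<p$; that is, there are $\xi\in\partial\Omega(u^\dagger)$ and constants $\varrho>c_p s^p\Omega(u^\dagger)$, $\bar\alpha>0$, $\beta_1\in[0,1)$, $\beta_2\ge 0$ such that $$-\xi(u-u^\dagger)\le\beta_1\mathcal{B}_\xi(u,u^\dagger)+\beta_2\,\mathcal{S}(F(u),F(u^\dagger))^\kappa\quad\text{for all }u\in M_{\bar\alpha}(\varrho\bar\alpha).$$ Let $\delta\mapsto\alpha(\delta)\in(0,\infty)$ be an a priori parameter choice for which there are constants $\underline{c}>0$, $\overline{c}>0$ with $\underline{c}\,\delta^{p-\kappa}\le\alpha(\delta)\le\overline{c}\,\delta^{p-\kappa}$ for all sufficiently small $\delta>0$. Let $u_{\alpha(\delta)}^\delta$ be a minimizer of $\mathcal{T}_{\alpha(\delta)}^\delta$ over $D$ for each $\delta>0$. Then $$\mathcal{B}_\xi(u_{\alpha(\delta)}^\delta,u^\dagger)=O(\delta^\kappa)\quad\text{as }\delta\to 0.$$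
   Context: Setting. $U$ is a real Hausdorff topological vector space with topology $\tau_U$, $V$ is a Hausdorff topological space with topology $\tau_V$; convergence of sequences in $\tau_U$ or $\tau_V$ is written $\rightharpoonup$. $U^*$ is the set of all $\tau_U$-continuous linear functionals on $U$. $F:D(F)\subseteq U\to V$ is a (possibly nonlinear) operator, $v^0\in V$ is the exact data, $\mathcal{S}:V\times V\to[0,\infty]$ is a similarity functional, $\Omega:U\to[0,\infty]$ is a stabilizing functional, $p\in(0,\infty)$ is a fixed exponent. For each noise level $\delta>0$, $v^\delta\in V$ is noisy data with $\mathcal{S}(v^\delta,v^0)\le\delta$ and $\mathcal{S}(v^0,v^\delta)\le\delta$. Put $D(\Omega)=\{u\in U:\Omega(u)<\infty\}$, $D=D(F)\cap D(\Omega)$, and for $\alpha>0$ $$\mathcal{T}_\alpha^\delta(u)=\mathcal{S}(F(u),v^\delta)^p+\alpha\Omega(u),\quad \mathcal{T}_\alpha^0(u)=\mathcal{S}(F(u),v^0)^p+\alpha\Omega(u),\quad M_\alpha(c)=\{u\in D:\mathcal{T}_\alpha^0(u)\le c\}.$$ Standing assumptions. (i) $F$ is sequentially continuous: $u_k\rightharpoonup u$ with $u,u_k\in D(F)$ implies $F(u_k)\rightharpoonup F(u)$. (ii) $D(F)$ is sequentially closed with respect to $\tau_U$. (iii) There is $u\in D$ with $F(u)=v^0$. (iv) (a) $\mathcal{S}(v,\tilde v)=0$ iff $v=\tilde v$; (b) there is $s\ge1$ with $\mathcal{S}(v_1,v_2)\le s\,\mathcal{S}(v_1,v_3)+s\,\mathcal{S}(v_3,v_2)$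 for all $v_1,v_2,v_3\in V$; (c) $v_k\rightharpoonup v$, $\tilde v_k\rightharpoonup\tilde v$ implies $\mathcal{S}(v,\tilde v)\le\liminf_k\mathcal{S}(v_k,\tilde v_k)$; (d) $\mathcal{S}(v_k,v)\to0$ implies $v_k\rightharpoonup v$; (e) if $\mathcal{S}(v_k,v)\to0$, $\mathcal{S}(v,v_k)\to0$ and $\mathcal{S}(\tilde v,v)<\infty$, then $\mathcal{S}(\tilde v,v_k)\to\mathcal{S}(\tilde v,v)$. (v) $\Omega$ is convex. (vi) $u_k\rightharpoonup u$ implies $\Omega(u)\le\liminf_k\Omega(u_k)$. (vii) For all $\alpha>0$, $c>0$, every sequence in $M_\alpha(c)$ has a $\tau_U$-convergent subsequence. The constant $s$ is the one in (iv)(b), and $c_p=1$ if $0<p<1$, $c_p=2^{p-1}$ if $p\ge1$. An $\Omega$-minimizing solution is an element $u^\dagger\in D$ with $F(u^\dagger)=v^0$ and $\Omega(u^\dagger)=\inf\{\Omega(u):u\in D,\ F(u)=v^0\}$. The subdifferential is $\partial\Omega(\tilde u)=\{\xi\in U^*:\Omega(u)\ge\Omega(\tilde u)+\xi(u-\tilde u)\ \forall u\in U\}$ for $\tilde u\in D(\Omega)$, and for $\xi\in\partial\Omega(\tilde u)$ the Bregman distance is $\mathcal{B}_\xi(u,\tilde u)=\Omega(u)-\Omega(\tilde u)-\xi(u-\tilde u)$. *)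

theory Defs
  imports "HOL-Analysis.Analysis"
begin

text \<open>
  Real Hausdorff topological vector spaces, without any local convexity, norm or metric.
  The library provides continuity of addition and negation, but joint continuity of scalar
  multiplication only for normed spaces.
\<close>

class real_hausdorff_tvs = real_vector + topological_ab_group_add + t2_space +
  assumes tendsto_scaleR_Pair:
    "LIM x (nhds a \<times>\<^sub>F nhds b). fst x *\<^sub>R snd x :> nhds (a *\<^sub>R b)"

definition continuous_dual :: "('u::real_hausdorff_tvs \<Rightarrow> real) set" where
  "continuous_dual = {\<xi>. linear \<xi> \<and> continuous_on UNIV \<xi>}"

text \<open>
  Real powers on \<open>[0,\<infinity>]\<close>; used for exponents \<open>q > 0\<close> only, whence \<open>\<infinity>\<close> is sent to \<open>\<infinity>\<close>
  (and \<open>0\<close> to \<open>0\<close>).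
\<close>

definition ennpowr :: "ennreal \<Rightarrow> real \<Rightarrow> ennreal" where
  "ennpowr x q = (if x = \<infinity> then \<infinity> else ennreal (enn2real x powr q))"

definition eff_domain :: "('u \<Rightarrow> ennreal) \<Rightarrow> 'u set" where
  "eff_domain Omega = {u. Omega u < \<infinity>}"

text \<open>
  A partial operator \<open>F\<close> is a total function together with its domain \<open>DF\<close>; values of \<open>F\<close>
  outside \<open>DF\<close> are never used.  The argument \<open>w\<close> is the data, noisy or exact.
\<close>

definition tikhonov ::
  "('u \<Rightarrow> 'v) \<Rightarrow> ('v \<Rightarrow> 'v \<Rightarrow> ennreal) \<Rightarrow> ('u \<Rightarrow> ennreal) \<Rightarrow> real \<Rightarrow> 'v \<Rightarrow> real \<Rightarrow> 'u \<Rightarrow> ennreal" where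
  "tikhonov F S Omega p w \<alpha> u = ennpowr (S (F u) w) p + ennreal \<alpha> * Omega u"

definition sublevel ::
  "'u set \<Rightarrow> ('u \<Rightarrow> 'v) \<Rightarrow> ('v \<Rightarrow> 'v \<Rightarrow> ennreal) \<Rightarrow> ('u \<Rightarrow> ennreal) \<Rightarrow> real \<Rightarrow> 'v
    \<Rightarrow> real \<Rightarrow> real \<Rightarrow> 'u set" where
  "sublevel DF F S Omega p v0 \<alpha> c =
     {u \<in> DF \<inter> eff_domain Omega. tikhonov F S Omega p v0 \<alpha> u \<le> ennreal c}"

definition minimizing_solution ::
  "'u set \<Rightarrow> ('u \<Rightarrow> 'v) \<Rightarrow> ('u \<Rightarrow> ennreal) \<Rightarrow> 'v \<Rightarrow> 'u \<Rightarrow> bool" where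
  "minimizing_solution DF F Omega v0 ud \<longleftrightarrow>
     ud \<in> DF \<inter> eff_domain Omega \<and> F ud = v0 \<and>
     Omega ud = (INF u\<in>{u \<in> DF \<inter> eff_domain Omega. F u = v0}. Omega u)"

text \<open>
  The subdifferential and the Bregman distance are meant at points \<open>ut\<close> of the effective domain;
  then \<open>\<infinity> - \<infinity>\<close> does not occur.
\<close>

definition subdifferential ::
  "('u::real_hausdorff_tvs \<Rightarrow> ennreal) \<Rightarrow> 'u \<Rightarrow> ('u \<Rightarrow> real) set" where
  "subdifferential Omega ut =
     {\<xi> \<in> continuous_dual. \<forall>u. enn2ereal (Omega u) \<ge> enn2ereal (Omega ut) + ereal (\<xi> (u - ut))}"

definition bregman ::
  "('u::real_hausdorff_tvs \<Rightarrow> ennreal) \<Rightarrow> ('u \<Rightarrow> real) \<Rightarrow> 'u \<Rightarrow> 'u \<Rightarrow> ereal" where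
  "bregman Omega \<xi> u ut = enn2ereal (Omega u) - enn2ereal (Omega ut) - ereal (\<xi> (u - ut))"

definition c_const :: "real \<Rightarrow> real" where
  "c_const p = (if p < 1 then 1 else 2 powr (p - 1))"

text \<open>
  The variational inequality with the subgradient \<open>\<xi>\<close> exposed.  On the sublevel set all terms
  of the inequality are finite.
\<close>

definition variational_inequality ::
  "'u::real_hausdorff_tvs set \<Rightarrow> ('u \<Rightarrow> 'v) \<Rightarrow> ('v \<Rightarrow> 'v \<Rightarrow> ennreal) \<Rightarrow> ('u \<Rightarrow> ennreal) \<Rightarrow> real \<Rightarrow> real
    \<Rightarrow> 'v \<Rightarrow> real \<Rightarrow> 'u \<Rightarrow> ('u \<Rightarrow> real) \<Rightarrow> bool" where
  "variational_inequality DF F S Omega p s v0 \<kappa> ud \<xi> \<longleftrightarrow>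
     \<xi> \<in> subdifferential Omega ud \<and>
     (\<exists>\<rho> \<alpha>bar \<beta>1 \<beta>2 :: real.
        ennreal \<rho> > ennreal (c_const p * s powr p) * Omega ud \<and> \<alpha>bar > 0 \<and>
        0 \<le> \<beta>1 \<and> \<beta>1 < 1 \<and> \<beta>2 \<ge> 0 \<and>
        (\<forall>u \<in> sublevel DF F S Omega p v0 \<alpha>bar (\<rho> * \<alpha>bar).
           ereal (- \<xi> (u - ud))
             \<le> ereal \<beta>1 * bregman Omega \<xi> u ud
                + ereal \<beta>2 * enn2ereal (ennpowr (S (F u) (F ud)) \<kappa>)))"

locale tikhonov_setting =
  fixes DF :: "'u::real_hausdorff_tvs set"
    and F :: "'u \<Rightarrow> 'v::t2_space"
    and S :: "'v \<Rightarrow> 'v \<Rightarrow> ennreal"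
    and Omega :: "'u \<Rightarrow> ennreal"
    and p :: real
    and s :: real
    and v0 :: 'v
  assumes p_pos: "0 < p"
    and F_seq_continuous:
      "\<And>x u. \<lbrakk>\<And>k::nat. x k \<in> DF; u \<in> DF; x \<longlonglongrightarrow> u\<rbrakk> \<Longrightarrow> (\<lambda>k. F (x k)) \<longlonglongrightarrow> F u"
    and DF_seq_closed:
      "\<And>x u. \<lbrakk>\<And>k::nat. x k \<in> DF; x \<longlonglongrightarrow> u\<rbrakk> \<Longrightarrow> u \<in> DF"
    and solution_exists: "\<exists>u \<in> DF \<inter> eff_domain Omega. F u = v0"
    and S_eq_0_iff: "\<And>v w. S v w = 0 \<longleftrightarrow> v = w"
    and s_ge_1: "1 \<le> s"
    and S_quasi_triangle:
      "\<And>v1 v2 v3. S v1 v2 \<le> ennreal s * S v1 v3 + ennreal s * S v3 v2"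
    and S_seq_lsc:
      "\<And>(x::nat \<Rightarrow> 'v) y v w. \<lbrakk>x \<longlonglongrightarrow> v; y \<longlonglongrightarrow> w\<rbrakk>
         \<Longrightarrow> S v w \<le> liminf (\<lambda>k. S (x k) (y k))"
    and S_imp_tendsto:
      "\<And>(x::nat \<Rightarrow> 'v) v. (\<lambda>k. S (x k) v) \<longlonglongrightarrow> 0 \<Longrightarrow> x \<longlonglongrightarrow> v"
    and S_continuous:
      "\<And>(x::nat \<Rightarrow> 'v) v w. \<lbrakk>(\<lambda>k. S (x k) v) \<longlonglongrightarrow> 0; (\<lambda>k. S v (x k)) \<longlonglongrightarrow> 0; S w v < \<infinity>\<rbrakk>
         \<Longrightarrow> (\<lambda>k. S w (x k)) \<longlonglongrightarrow> S w v"
    and Omega_convex: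
      "\<And>u w t. \<lbrakk>0 \<le> t; t \<le> 1\<rbrakk>
         \<Longrightarrow> Omega (t *\<^sub>R u + (1 - t) *\<^sub>R w) \<le> ennreal t * Omega u + ennreal (1 - t) * Omega w"
    and Omega_seq_lsc:
      "\<And>(x::nat \<Rightarrow> 'u) u. x \<longlonglongrightarrow> u \<Longrightarrow> Omega u \<le> liminf (\<lambda>k. Omega (x k))"
    and sublevel_precompact:
      "\<And>\<alpha> c (x::nat \<Rightarrow> 'u). \<lbrakk>0 < \<alpha>; 0 < c; \<And>k. x k \<in> sublevel DF F S Omega p v0 \<alpha> c\<rbrakk>
         \<Longrightarrow> \<exists>r u. strict_mono (r::nat \<Rightarrow> nat) \<and> (x \<circ> r) \<longlonglongrightarrow> u"

end

theory Submission
  imports Defs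
begin

text \<open>
  Comparing the minimizer \<open>u\<close> with \<open>ud\<close> gives
  \<open>S (F u) v\<^sub>\<delta>\<^sup>p + \<alpha> Omega u \<le> \<delta>\<^sup>p + \<alpha> Omega ud\<close>.  Since \<open>\<delta>\<^sup>p / \<alpha> \<rightarrow> 0\<close> and \<open>\<alpha> \<rightarrow> 0\<close>, the quasi-triangle
  inequality puts \<open>u\<close> into the sublevel set on which the variational inequality holds, and there
  \<open>\<alpha> (1 - \<beta>\<^sub>1) B \<le> \<delta>\<^sup>p - x\<^sup>p + \<alpha> \<beta>\<^sub>2 s\<^sup>\<kappa> (x + \<delta>)\<^sup>\<kappa>\<close> with \<open>x = S (F u) v\<^sub>\<delta>\<close>.  As the Bregman distance \<open>B\<close> is
  nonnegative and \<open>\<alpha>\<close> is at most of order \<open>\<delta>\<^bsup>p-\<kappa>\<^esup>\<close>, this first forces \<open>x = O(\<delta>)\<close>; feeding that back and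
  dividing by \<open>\<alpha>\<close>, which is at least of order \<open>\<delta>\<^bsup>p-\<kappa>\<^esup>\<close>, yields \<open>B = O(\<delta>\<^sup>\<kappa>)\<close>.
\<close>

section \<open>Elementary inequalities for real powers\<close>

lemma c_const_ge_1: "1 \<le> c_const p"
  by (simp add: c_const_def ge_one_powr_ge_zero)

text \<open>For \<open>p < 1\<close>, the fractions \<open>a / (a + b)\<close> and
  \<open>b / (a + b)\<close> sum to 1 and lie in [0,1], where t \<le> t^p. For
  \<open>p \<ge> 1\<close> it is convexity of the power at the midpoint.\<close>

lemma powr_add_le_c_const:
  fixes a b p :: real
  assumes "0 \<le> a" "0 \<le> b" "0 < p"
  shows "(a + b) powr p \<le> c_const p * (a powr p + b powr p)"
proof (cases "a = 0 \<or> b = 0")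
  case True
  then show ?thesis
    using c_const_ge_1[of p] mult_right_mono[of 1 "c_const p" "a powr p + b powr p"] by auto
next
  case False
  then have ab: "0 < a" "0 < b" using assms by auto
  show ?thesis
  proof (cases "p < 1")
    case True
    have frac: "t / (a + b) \<le> (t / (a + b)) powr p" if "0 \<le> t" "t \<le> a + b" for t
      using that ab True powr_mono'[of p 1 "t / (a + b)"] by simp
    have "1 = a / (a + b) + b / (a + b)"
      using ab by (simp add: add_divide_distrib [symmetric])
    also have "\<dots> \<le> (a / (a + b)) powr p + (b / (a + b)) powr p"
      using frac[of a] frac[of b] ab by simp
    also have "\<dots> = (a powr p + b powr p) / (a + b) powr p"
      using ab by (simp add: powr_divide add_divide_distrib)
    finally show ?thesis
      using ab True by (simp add: c_const_def field_simps)
  next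
    case False
    have "((1 - 1/2) *\<^sub>R a + (1/2) *\<^sub>R b) powr p \<le> (1 - 1/2) * a powr p + 1/2 * b powr p"
      by (rule convex_onD[OF powr_convex]) (use False ab in auto)
    then have "((a + b) / 2) powr p \<le> (a powr p + b powr p) / 2"
      by (simp add: field_simps)
    then show ?thesis
      using False ab by (simp add: c_const_def powr_divide powr_diff field_simps)
  qed
qed

text \<open>If \<open>x > \<delta>\<close>, both terms on the right of the hypothesis are at most a
  multiple of \<open>\<delta> powr (p - \<kappa>) * x powr \<kappa>\<close>; cancelling
  \<open>x powr \<kappa>\<close> leaves a bound on \<open>x powr (p - \<kappa>)\<close>. If
  \<open>x \<le> \<delta>\<close>, it suffices that the constant is at least 1.\<close>

lemma powr_le_self_bound:
  fixes x \<delta> \<kappa> p K :: real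
  assumes "0 \<le> x" "0 < \<delta>" "0 < \<kappa>" "\<kappa> < p" "0 \<le> K"
    and le: "x powr p \<le> \<delta> powr p + K * \<delta> powr (p - \<kappa>) * (x + \<delta>) powr \<kappa>"
  shows "x \<le> (1 + K * 2 powr \<kappa>) powr (1 / (p - \<kappa>)) * \<delta>"
proof (cases "x \<le> \<delta>")
  case True
  have "1 \<le> (1 + K * 2 powr \<kappa>) powr (1 / (p - \<kappa>))"
    using assms by (intro ge_one_powr_ge_zero) auto
  with True assms show ?thesis
    by (intro order_trans[OF True]) (simp add: mult_le_cancel_right1)
next
  case False
  have d: "\<delta> powr p = \<delta> powr (p - \<kappa>) * \<delta> powr \<kappa>"
    by (simp add: powr_add [symmetric])
  have "x powr (p - \<kappa>) * x powr \<kappa> = x powr p"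
    by (simp add: powr_add [symmetric])
  also have "\<dots> \<le> \<delta> powr (p - \<kappa>) * x powr \<kappa> + K * \<delta> powr (p - \<kappa>) * (2 * x) powr \<kappa>"
    using False assms d
    by (intro order_trans[OF le] add_mono mult_left_mono)
       (auto intro!: powr_mono2 mult_left_mono)
  also have "\<dots> = ((1 + K * 2 powr \<kappa>) * \<delta> powr (p - \<kappa>)) * x powr \<kappa>"
    using assms by (simp add: powr_mult algebra_simps)
  finally have "x powr (p - \<kappa>) \<le> (1 + K * 2 powr \<kappa>) * \<delta> powr (p - \<kappa>)"
    using False assms by simp
  then have "(x powr (p - \<kappa>)) powr (1 / (p - \<kappa>))
      \<le> ((1 + K * 2 powr \<kappa>) * \<delta> powr (p - \<kappa>)) powr (1 / (p - \<kappa>))"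
    using assms by (intro powr_mono2) auto
  also have "\<dots> = (1 + K * 2 powr \<kappa>) powr (1 / (p - \<kappa>)) * \<delta>"
    using assms by (simp add: powr_mult powr_powr)
  finally show ?thesis
    using assms by (simp add: powr_powr)
qed

section \<open>Passage from extended to real values\<close>

lemma ennpowr_ennreal: "0 \<le> x \<Longrightarrow> ennpowr (ennreal x) q = ennreal (x powr q)"
  by (simp add: ennpowr_def)

lemma ennpowr_finite_iff: "ennpowr x q < top \<longleftrightarrow> x < top"
  by (simp add: ennpowr_def less_top)

lemma tikhonov_ennreal:
  assumes "S (F u) w = ennreal x" "Omega u = ennreal y" "0 \<le> x" "0 \<le> y" "0 \<le> \<alpha>"
  shows "tikhonov F S Omega p w \<alpha> u = ennreal (x powr p + \<alpha> * y)"
  using assms by (simp add: tikhonov_def ennpowr_ennreal ennreal_mult)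

lemma bregman_ennreal:
  assumes "Omega u = ennreal y" "Omega ut = ennreal z" "0 \<le> y" "0 \<le> z"
  shows "bregman Omega \<xi> u ut = ereal (y - z - \<xi> (u - ut))"
  using assms by (simp add: bregman_def enn2ereal_ennreal)

theorem theorem3p4:
  fixes DF :: "'u::real_hausdorff_tvs set"
    and F :: "'u \<Rightarrow> 'v::t2_space"
    and S :: "'v \<Rightarrow> 'v \<Rightarrow> ennreal"
    and Omega :: "'u \<Rightarrow> ennreal"
    and p s \<kappa> c_lower c_upper :: real
    and v0 :: 'v
    and v_noisy :: "real \<Rightarrow> 'v"
    and ud :: 'u
    and \<xi> :: "'u \<Rightarrow> real"
    and \<alpha> :: "real \<Rightarrow> real"
    and u_min :: "real \<Rightarrow> 'u"
  assumes setting: "tikhonov_setting DF F S Omega p s v0"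
    and noise: "\<And>\<delta>. 0 < \<delta> \<Longrightarrow> S (v_noisy \<delta>) v0 \<le> ennreal \<delta> \<and> S v0 (v_noisy \<delta>) \<le> ennreal \<delta>"
    and solution: "minimizing_solution DF F Omega v0 ud"
    and kappa: "0 < \<kappa>" "\<kappa> < p"
    and vi: "variational_inequality DF F S Omega p s v0 \<kappa> ud \<xi>"
    and alpha_pos: "\<And>\<delta>. 0 < \<delta> \<Longrightarrow> 0 < \<alpha> \<delta>"
    and c_pos: "0 < c_lower" "0 < c_upper"
    and alpha_choice:
      "\<forall>\<^sub>F \<delta> in at_right 0.
         c_lower * \<delta> powr (p - \<kappa>) \<le> \<alpha> \<delta> \<and> \<alpha> \<delta> \<le> c_upper * \<delta> powr (p - \<kappa>)"
    and minimizer: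
      "\<And>\<delta>. 0 < \<delta> \<Longrightarrow>
         is_arg_min (tikhonov F S Omega p (v_noisy \<delta>) (\<alpha> \<delta>))
           (\<lambda>u. u \<in> DF \<inter> eff_domain Omega) (u_min \<delta>)"
  shows "\<exists>C>0. \<forall>\<^sub>F \<delta> in at_right 0.
           \<bar>bregman Omega \<xi> (u_min \<delta>) ud\<bar> \<le> ereal (C * \<delta> powr \<kappa>)"
proof -
  interpret tikhonov_setting DF F S Omega p s v0 by (rule setting)
  obtain \<rho> \<alpha>bar \<beta>1 \<beta>2 :: real where
    rho: "ennreal \<rho> > ennreal (c_const p * s powr p) * Omega ud"
    and abar: "0 < \<alpha>bar" and b1: "0 \<le> \<beta>1" "\<beta>1 < 1" and b2: "0 \<le> \<beta>2"
    and vi_le: "\<And>u. u \<in> sublevel DF F S Omega p v0 \<alpha>bar (\<rho> * \<alpha>bar) \<Longrightarrow>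
           ereal (- \<xi> (u - ud)) \<le> ereal \<beta>1 * bregman Omega \<xi> u ud
                + ereal \<beta>2 * enn2ereal (ennpowr (S (F u) (F ud)) \<kappa>)"
    and subgrad: "\<xi> \<in> subdifferential Omega ud"
    using vi unfolding variational_inequality_def by blast
  have ud: "ud \<in> DF" "Omega ud < \<infinity>" "F ud = v0"
    using solution by (auto simp: minimizing_solution_def eff_domain_def)
  define z where "z = enn2real (Omega ud)"
  have z: "Omega ud = ennreal z" "0 \<le> z"
    using ud(2) by (simp_all add: z_def)
  define A where "A = c_const p * s powr p"
  have A1: "1 \<le> A"
    using c_const_ge_1[of p] s_ge_1 p_pos mult_mono[of 1 "c_const p" 1 "s powr p"]
    by (simp add: A_def ge_one_powr_ge_zero)
  have "ennreal (A * z) < ennreal \<rho>"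
    using rho z A1 by (simp add: A_def ennreal_mult')
  then have rho': "A * z < \<rho>"
    using A1 z by (simp add: ennreal_less_iff)
  \<comment> \<open>\<open>K\<close> and \<open>L\<close> are the constants of
    \<open>powr_le_self_bound\<close>, which will give \<open>x \<le> L * \<delta>\<close>. In
    \<open>C\<close>, the summand \<open>1 / c_lower\<close> comes from \<delta>^p / \<alpha>, the
    other from the variational inequality, and the division absorbs
    \<open>\<beta>1 * B\<close>.\<close>
  define K where "K = c_upper * \<beta>2 * s powr \<kappa>"
  have K: "0 \<le> K" using b2 c_pos by (simp add: K_def)
  define L where "L = (1 + K * 2 powr \<kappa>) powr (1 / (p - \<kappa>))"
  define C where "C = (1 / c_lower + \<beta>2 * s powr \<kappa> * (L + 1) powr \<kappa>) / (1 - \<beta>1)"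
  have C_eq: "(1 - \<beta>1) * C = 1 / c_lower + \<beta>2 * s powr \<kappa> * (L + 1) powr \<kappa>"
    using b1 by (simp add: C_def)
  have C: "0 < C"
    using b1 b2 c_pos by (auto simp: C_def intro!: divide_pos_pos add_pos_nonneg)

  \<comment> \<open>The exponents are positive, so the powers of \<delta> tend to 0. This gives
    \<alpha> < \<open>\<alpha>bar\<close> eventually, and the strict gap
    \<open>A * z < \<rho>\<close> leaves room for the noise term.\<close>
  have "((\<lambda>\<delta>. c_upper * \<delta> powr (p - \<kappa>)) \<longlongrightarrow> c_upper * 0 powr (p - \<kappa>)) (at_right 0)"
    using kappa
    by (intro tendsto_intros tendsto_powr') (auto simp: eventually_at_right_less eventually_at_filter)
  then have ev_alpha: "\<forall>\<^sub>F \<delta> in at_right 0. c_upper * \<delta> powr (p - \<kappa>) < \<alpha>bar"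
    using abar by (auto dest: order_tendstoD)
  have "((\<lambda>\<delta>. A * (2 * (\<delta> powr \<kappa> / c_lower) + z))
      \<longlongrightarrow> A * (2 * (0 powr \<kappa> / c_lower) + z)) (at_right 0)"
    using kappa c_pos
    by (intro tendsto_intros tendsto_powr') (auto simp: eventually_at_right_less eventually_at_filter)
  then have ev_rho: "\<forall>\<^sub>F \<delta> in at_right 0. A * (2 * (\<delta> powr \<kappa> / c_lower) + z) < \<rho>"
    using rho' by (auto dest: order_tendstoD)

  have main: "\<bar>bregman Omega \<xi> (u_min \<delta>) ud\<bar> \<le> ereal (C * \<delta> powr \<kappa>)"
    if \<delta>: "0 < \<delta>"
      and lo: "c_lower * \<delta> powr (p - \<kappa>) \<le> \<alpha> \<delta>" and up: "\<alpha> \<delta> \<le> c_upper * \<delta> powr (p - \<kappa>)"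
      and small: "c_upper * \<delta> powr (p - \<kappa>) < \<alpha>bar"
      and near: "A * (2 * (\<delta> powr \<kappa> / c_lower) + z) < \<rho>" for \<delta>
  proof -
    define a where "a = \<alpha> \<delta>"
    define u where "u = u_min \<delta>"
    define w where "w = v_noisy \<delta>"
    have a: "0 < a" "a < \<alpha>bar" using alpha_pos[OF \<delta>] up small by (auto simp: a_def)
    have u: "u \<in> DF" "Omega u < \<infinity>"
      and min: "tikhonov F S Omega p w a u \<le> tikhonov F S Omega p w a ud"
      using minimizer[OF \<delta>] ud
      by (auto simp: is_arg_min_def eff_domain_def u_def w_def a_def not_less)
    \<comment> \<open>\<open>q\<close> bounds \<delta>^p / a, by the lower bound in the parameter
      choice.\<close>
    define q where "q = \<delta> powr \<kappa> / c_lower"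
    have "\<delta> powr p = q * (c_lower * \<delta> powr (p - \<kappa>))"
      using c_pos by (simp add: q_def powr_add [symmetric])
    also have "\<dots> \<le> q * a"
      using lo c_pos by (intro mult_left_mono) (auto simp: a_def q_def)
    finally have dp: "\<delta> powr p \<le> q * a" .

    \<comment> \<open>Comparison of the minimizer with \<open>ud\<close>\<close>
    define y where "y = enn2real (Omega u)"
    have y: "Omega u = ennreal y" "0 \<le> y" using u(2) by (simp_all add: y_def)
    obtain e where e: "S v0 w = ennreal e" "0 \<le> e" "e \<le> \<delta>"
      using noise[OF \<delta>] \<delta> by (auto simp: w_def le_ennreal_iff)
    have "tikhonov F S Omega p w a ud = ennreal (e powr p + a * z)"
      using tikhonov_ennreal[of S F ud w e Omega z a] ud e z a by simp
    also have "\<dots> \<le> ennreal (\<delta> powr p + a * z)"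
      using e p_pos by (intro ennreal_leI add_right_mono powr_mono2) auto
    finally have le: "tikhonov F S Omega p w a u \<le> ennreal (\<delta> powr p + a * z)"
      using min by simp
    \<comment> \<open>Finiteness of \<open>S (F u) w\<close> is obtained from the bound on the
      functional; from here on the estimates are real.\<close>
    then have "ennpowr (S (F u) w) p + ennreal a * Omega u < \<infinity>"
      unfolding tikhonov_def by (rule le_less_trans) simp
    then have fin: "S (F u) w < \<infinity>"
      by (simp add: ennpowr_finite_iff)
    define x where "x = enn2real (S (F u) w)"
    have x: "S (F u) w = ennreal x" "0 \<le> x" using fin by (simp_all add: x_def)
    have xy: "x powr p + a * y \<le> \<delta> powr p + a * z"
      using le a z tikhonov_ennreal[of S F u w x Omega y a p] x y
      by (simp add: ennreal_le_iff del: ennreal_plus)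

    \<comment> \<open>Membership in the sublevel set\<close>
    have "S (F u) v0 \<le> ennreal s * S (F u) w + ennreal s * S w v0"
      by (rule S_quasi_triangle)
    also have "\<dots> \<le> ennreal s * ennreal x + ennreal s * ennreal \<delta>"
      using noise[OF \<delta>] x by (intro add_mono mult_left_mono) (auto simp: w_def)
    also have "\<dots> = ennreal (s * (x + \<delta>))"
      using x \<delta> s_ge_1 by (simp add: ennreal_mult' distrib_left)
    finally obtain r where r: "S (F u) v0 = ennreal r" "0 \<le> r" "r \<le> s * (x + \<delta>)"
      using x \<delta> s_ge_1 by (auto simp: le_ennreal_iff)
    have "r powr p \<le> (s * (x + \<delta>)) powr p"
      using r p_pos by (intro powr_mono2) auto
    also have "\<dots> = s powr p * (x + \<delta>) powr p"
      using s_ge_1 x \<delta> by (simp add: powr_mult)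
    also have "\<dots> \<le> s powr p * (c_const p * (x powr p + \<delta> powr p))"
      using powr_add_le_c_const[of x \<delta> p] x \<delta> p_pos by (intro mult_left_mono) auto
    finally have rp: "r powr p \<le> A * (x powr p + \<delta> powr p)"
      by (simp add: A_def mult_ac)

    \<comment> \<open>As \<open>A \<ge> 1\<close>, the penalty also fits under the factor
      \<open>A\<close>, so \<open>xy\<close> applies to the whole sum. One \<open>q\<close> comes
      from \<open>xy\<close>, the other from the quasi-triangle inequality.\<close>
    have "r powr p + a * y \<le> A * (x powr p + \<delta> powr p) + A * (a * y)"
      using rp mult_right_mono[of 1 A "a * y"] A1 a y by (intro add_mono) simp_all
    also have "\<dots> = A * (x powr p + a * y + \<delta> powr p)"
      by (simp add: algebra_simps)
    also have "\<dots> \<le> A * (q * a + a * z + q * a)"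
      using xy dp A1 by (intro mult_left_mono) linarith+
    also have "\<dots> = a * (A * (2 * q + z))"
      by (simp add: algebra_simps)
    also have "\<dots> \<le> a * \<rho>"
      using near a unfolding q_def by (intro mult_left_mono) auto
    finally have ta: "r powr p + a * y \<le> a * \<rho>" .
    \<comment> \<open>Passing from \<open>a\<close> to the larger \<open>\<alpha>bar\<close>
      rescales the penalty exactly, while the data term only grows by the factor
      \<open>\<alpha>bar / a \<ge> 1\<close>.\<close>
    have "r powr p + \<alpha>bar * y \<le> \<alpha>bar / a * (r powr p + a * y)"
    proof -
      have "r powr p \<le> \<alpha>bar / a * r powr p"
        using a mult_right_mono[of 1 "\<alpha>bar / a" "r powr p"] by simp
      then show ?thesis using a by (simp add: distrib_left)
    qed
    also have "\<dots> \<le> \<alpha>bar / a * (a * \<rho>)"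
      using ta a by (intro mult_left_mono) auto
    also have "\<dots> = \<rho> * \<alpha>bar" using a by simp
    finally have "u \<in> sublevel DF F S Omega p v0 \<alpha>bar (\<rho> * \<alpha>bar)"
      using u r y abar tikhonov_ennreal[of S F u v0 r Omega y \<alpha>bar p]
      by (simp add: sublevel_def eff_domain_def ennreal_leI del: ennreal_plus)
    note vi_u = vi_le[OF this]

    \<comment> \<open>Rates from the variational inequality\<close>
    define B where "B = y - z - \<xi> (u - ud)"
    have breg: "bregman Omega \<xi> u ud = ereal B"
      unfolding B_def using y z by (intro bregman_ennreal) auto
    have "- \<xi> (u - ud) \<le> \<beta>1 * B + \<beta>2 * r powr \<kappa>"
      using vi_u r by (simp add: breg ud ennpowr_ennreal enn2ereal_ennreal)
    then have "(1 - \<beta>1) * B \<le> y - z + \<beta>2 * r powr \<kappa>"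
      by (simp add: B_def algebra_simps)
    also have "\<dots> \<le> y - z + \<beta>2 * (s powr \<kappa> * (x + \<delta>) powr \<kappa>)"
      using r kappa b2 s_ge_1 x \<delta> powr_mono2[of \<kappa> r "s * (x + \<delta>)"]
      by (intro add_left_mono mult_left_mono) (auto simp: powr_mult)
    finally have B_le: "(1 - \<beta>1) * B \<le> y - z + \<beta>2 * s powr \<kappa> * (x + \<delta>) powr \<kappa>"
      by (simp add: mult.assoc)
    have B_ge: "0 \<le> B"
    proof -
      have "enn2ereal (Omega ud) + ereal (\<xi> (u - ud)) \<le> enn2ereal (Omega u)"
        using subgrad by (simp add: subdifferential_def)
      then show ?thesis using y z by (simp add: B_def enn2ereal_ennreal)
    qed

    \<comment> \<open>Since \<open>B \<ge> 0\<close>, the right side of \<open>B_le\<close> is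
      nonnegative. Adding it to \<open>xy\<close> cancels \<open>a * (y - z)\<close> and leaves an
      inequality in \<open>x\<close> alone.\<close>
    have "0 \<le> a * (y - z + \<beta>2 * s powr \<kappa> * (x + \<delta>) powr \<kappa>)"
      using B_le B_ge b1 a by (intro mult_nonneg_nonneg) (auto intro: order_trans[OF _ B_le])
    then have "x powr p \<le> \<delta> powr p + a * (\<beta>2 * s powr \<kappa> * (x + \<delta>) powr \<kappa>)"
      using xy by (simp add: algebra_simps)
    also have "\<dots> \<le> \<delta> powr p + c_upper * \<delta> powr (p - \<kappa>) * (\<beta>2 * s powr \<kappa> * (x + \<delta>) powr \<kappa>)"
      using up b2 by (intro add_left_mono mult_right_mono) (auto simp: a_def)
    also have "\<dots> = \<delta> powr p + K * \<delta> powr (p - \<kappa>) * (x + \<delta>) powr \<kappa>"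
      by (simp add: K_def)
    finally have "x \<le> L * \<delta>"
      unfolding L_def using x \<delta> kappa K by (intro powr_le_self_bound)
    then have "(x + \<delta>) powr \<kappa> \<le> ((L + 1) * \<delta>) powr \<kappa>"
      using x \<delta> kappa by (intro powr_mono2) (auto simp: algebra_simps)
    also have "\<dots> = (L + 1) powr \<kappa> * \<delta> powr \<kappa>"
      using \<delta> by (simp add: powr_mult L_def)
    finally have xd: "(x + \<delta>) powr \<kappa> \<le> (L + 1) powr \<kappa> * \<delta> powr \<kappa>" .
    \<comment> \<open>Now \<open>x powr p\<close> is dropped from \<open>xy\<close>, which bounds
      \<open>y - z\<close> by \<open>q\<close>, of order \<delta>^\<kappa>.\<close>
    have "a * y - a * z \<le> q * a"
      using xy dp powr_ge_zero[of x p] by linarith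
    then have "a * (y - z) \<le> a * q"
      by (simp add: algebra_simps)
    then have "y - z \<le> q"
      using a by (simp only: mult_le_cancel_left_pos)
    then have "(1 - \<beta>1) * B \<le> q + \<beta>2 * s powr \<kappa> * ((L + 1) powr \<kappa> * \<delta> powr \<kappa>)"
      using b2 xd by (intro order_trans[OF B_le] add_mono mult_left_mono) auto
    also have "\<dots> = (1 - \<beta>1) * C * \<delta> powr \<kappa>"
      unfolding C_eq q_def by (simp add: algebra_simps)
    finally have "B \<le> C * \<delta> powr \<kappa>"
      using b1 by simp
    then show ?thesis
      using B_ge breg by (simp add: u_def)
  qed
  have "\<forall>\<^sub>F \<delta> in at_right 0. \<bar>bregman Omega \<xi> (u_min \<delta>) ud\<bar> \<le> ereal (C * \<delta> powr \<kappa>)"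
    using eventually_at_right_less[of "0::real"] alpha_choice ev_alpha ev_rho
    by eventually_elim (use main in blast)
  with C show ?thesis by blast
qed

end
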